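(* Let $A$ be a closed subset of $G=[0,1]$ and let $\epsilon>0$. Let $f\in C(A)$ be such that $0\le f(x)\le 1$ for all $x\in A$, $f(0)=0$ if $0\in A$, and $f(1)=1$ if $1\in A$. Then there exists $p\in\mathcal{P}'$ with $\sup_{x\in A}|p(x)-f(x)|<\epsilon$.
   Context: $C(A)$ denotes the continuous real-valued functions on $A$. $\mathcal{P}'$ is the set of real univariate polynomials $p$ satisfying: (i) $p(x)\in(0,1)$ for all $x\in(0,1)$; (ii) $p(x)<0$ for all $x<0$; (iii) $p(x)>1$ for all $x>1$. *)

theory Defs
  imports "HOL-Analysis.Analysis" "HOL-Computational_Algebra.Polynomial"
begin

definition P' :: "real poly set" where
  "P' = {p. (\<forall>x. 0 < x \<and> x < 1 \<longrightarrow> 0 < poly p x \<and> poly p x < 1)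
          \<and> (\<forall>x. x < 0 \<longrightarrow> poly p x < 0)
          \<and> (\<forall>x. 1 < x \<longrightarrow> 1 < poly p x)}"

end

theory Submission
  imports Defs
begin

text \<open>
  Every polynomial fixing 0 and 1 has the form \<open>p = x + x (1 - x) s\<close>, and then
  \<open>p = x (1 + (1 - x) s)\<close> and \<open>1 - p = (1 - x) (1 - x s)\<close>. The sign conditions on \<open>p\<close> therefore
  hold as soon as both cofactors \<open>1 + (1 - x) s\<close> and \<open>1 - x s\<close> are positive on the whole line
  (\<open>P'_if_cofactors_pos\<close>). The problem becomes one about \<open>s\<close>, without any interpolation condition.

  Positivity outside the unit interval comes for free (\<open>perturb_into_P'\<close>). To the right of 1 both
  cofactors grow when \<open>s\<close> decreases, and to the left of 0 both grow when \<open>s\<close> increases. Subtracting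
  \<open>c (2 x - 1) ^ N\<close> with \<open>N\<close> odd does exactly this, changes \<open>s\<close> by at most \<open>c\<close> on the unit
  interval, and for large \<open>N\<close> overwhelms \<open>s\<close> away from the interval. Just outside the endpoints
  the cofactors are positive by continuity.

  It remains to approximate on the unit interval. With \<open>g\<close> a continuous extension of \<open>f\<close> with
  values in the unit interval, the ideal \<open>s\<close> is \<open>(g - x) / (x (1 - x))\<close>, which may be unbounded at the
  endpoints. Adding a small \<open>\<tau>\<close> to the denominator makes it continuous, and a factor \<open>1 - \<eta>\<close>
  keeps both cofactors at least \<open>\<eta>\<close>, which leaves room for a Weierstrass approximation. The
  regularisation replaces \<open>g\<close> by a convex combination of \<open>g\<close> and the identity that differs from \<open>g\<close>
  noticeably only near 0 and 1. On \<open>A\<close> this is harmless: the points of \<open>A\<close> where \<open>f\<close> is not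
  already close to the identity form a compact set, and since \<open>f 0 = 0\<close> and \<open>f 1 = 1\<close> whenever
  these endpoints lie in \<open>A\<close>, that set avoids 0 and 1.
\<close>

section \<open>Sign conditions through cofactors\<close>

lemma P'_if_cofactors_pos:
  fixes s :: "real poly"
  assumes "\<And>x. 0 < 1 + (1 - x) * poly s x" and "\<And>x. 0 < 1 - x * poly s x"
  shows "[:0, 1:] + [:0, 1, -1:] * s \<in> P'"
proof -
  let ?p = "[:0, 1:] + [:0, 1, -1:] * s"
  have p: "poly ?p x = x * (1 + (1 - x) * poly s x)" for x
    by (simp add: algebra_simps)
  have q: "1 - poly ?p x = (1 - x) * (1 - x * poly s x)" for x
    by (simp add: algebra_simps)
  have "0 < poly ?p x" if "0 < x" for x
    unfolding p using assms(1)[of x] that by (rule mult_pos_pos[rotated])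
  moreover have "poly ?p x < 0" if "x < 0" for x
    unfolding p using assms(1)[of x] that by (simp add: mult_neg_pos)
  moreover have "poly ?p x < 1" if "x < 1" for x
    using mult_pos_pos[of "1 - x", OF _ assms(2)[of x]] that q[of x] by linarith
  moreover have "1 < poly ?p x" if "1 < x" for x
    using mult_neg_pos[of "1 - x", OF _ assms(2)[of x]] that q[of x] by linarith
  ultimately show ?thesis
    unfolding P'_def by blast
qed

section \<open>Domination by odd powers outside the unit interval\<close>

text \<open>
  The variable \<open>2 * x - 1\<close> maps the unit interval to \<open>{-1..1}\<close>, so its powers are at most 1 in modulus there and
  grow exponentially in the exponent outside.
\<close>

lemma poly_bounded_by_power:
  fixes s :: "real poly"
  obtains C d where "0 \<le> C"
    and "\<And>x. 1 \<le> \<bar>2 * x - 1\<bar> \<Longrightarrow> \<bar>poly s x\<bar> \<le> C * \<bar>2 * x - 1\<bar> ^ d"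
proof -
  have "\<exists>C d. 0 \<le> C \<and> (\<forall>x. 1 \<le> \<bar>2 * x - 1\<bar> \<longrightarrow> \<bar>poly s x\<bar> \<le> C * \<bar>2 * x - 1\<bar> ^ d)"
  proof (induction s)
    case 0
    show ?case by (intro exI[of _ 0]) simp
  next
    case (pCons a s)
    then obtain C d where C: "0 \<le> C"
      and bnd: "\<And>x. 1 \<le> \<bar>2 * x - 1\<bar> \<Longrightarrow> \<bar>poly s x\<bar> \<le> C * \<bar>2 * x - 1\<bar> ^ d"
      by blast
    have "\<bar>poly (pCons a s) x\<bar> \<le> (\<bar>a\<bar> + C) * \<bar>2 * x - 1\<bar> ^ Suc d" if x: "1 \<le> \<bar>2 * x - 1\<bar>" for x
    proof -
      have "\<bar>poly (pCons a s) x\<bar> \<le> \<bar>a\<bar> * 1 + \<bar>x\<bar> * \<bar>poly s x\<bar>"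
        by (simp flip: abs_mult)
      also have "\<dots> \<le> \<bar>a\<bar> * \<bar>2 * x - 1\<bar> ^ Suc d + \<bar>2 * x - 1\<bar> * (C * \<bar>2 * x - 1\<bar> ^ d)"
      proof (intro add_mono mult_mono bnd x)
        show "1 \<le> \<bar>2 * x - 1\<bar> ^ Suc d" using x by (rule one_le_power)
        show "\<bar>x\<bar> \<le> \<bar>2 * x - 1\<bar>" using x by linarith
      qed auto
      finally show ?thesis by (simp add: algebra_simps)
    qed
    moreover have "0 \<le> \<bar>a\<bar> + C" using C by simp
    ultimately show ?case by blast
  qed
  then show thesis using that by blast
qed

lemma poly_dominated_by_odd_power:
  fixes s :: "real poly"
  assumes "0 < c" and "0 < \<delta>"
  obtains N where "odd N"
    and "\<And>x. 1 + \<delta> \<le> \<bar>2 * x - 1\<bar> \<Longrightarrow> \<bar>poly s x\<bar> \<le> c * \<bar>2 * x - 1\<bar> ^ N"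
proof -
  obtain C d where C: "0 \<le> C"
    and bnd: "\<And>x. 1 \<le> \<bar>2 * x - 1\<bar> \<Longrightarrow> \<bar>poly s x\<bar> \<le> C * \<bar>2 * x - 1\<bar> ^ d"
    using poly_bounded_by_power by blast
  obtain k where k: "C / c < (1 + \<delta>) ^ k"
    using real_arch_pow[of "1 + \<delta>"] assms(2) by auto
  \<comment> \<open>Any odd exponent at least \<open>d + k\<close> works: \<open>d\<close> powers match the growth of the polynomial, and
    \<open>k\<close> further powers absorb the constant.\<close>
  define N where "N = 2 * (d + k) + 1"
  have "\<bar>poly s x\<bar> \<le> c * \<bar>2 * x - 1\<bar> ^ N" if x: "1 + \<delta> \<le> \<bar>2 * x - 1\<bar>" for x
  proof -
    let ?y = "\<bar>2 * x - 1\<bar>"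
    have y: "1 \<le> ?y" using x assms(2) by linarith
    have "C \<le> c * (1 + \<delta>) ^ k"
      using k assms(1) by (simp add: field_simps)
    also have "\<dots> \<le> c * ?y ^ k"
      using x assms by (intro mult_left_mono power_mono) auto
    finally have "C * ?y ^ d \<le> c * ?y ^ k * ?y ^ d"
      by (rule mult_right_mono) simp
    also have "\<dots> = c * ?y ^ (k + d)" by (simp add: power_add)
    also have "\<dots> \<le> c * ?y ^ N"
      using y assms(1) by (intro mult_left_mono power_increasing) (auto simp: N_def)
    finally show ?thesis using bnd[OF y] by linarith
  qed
  moreover have "odd N" by (simp add: N_def)
  ultimately show thesis using that by blast
qed

text \<open>
  Subtracting a multiple of an odd power of \<open>2 * x - 1\<close> moves \<open>s0\<close> in the favourable direction on
  either side of the unit interval: both cofactors increase there. Once the new polynomial is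
  nonpositive to the right, or nonnegative to the left, both cofactors are at least 1. Inside the
  interval the margin \<open>c\<close> in the hypotheses pays for the change.
\<close>

lemma perturb_into_P':
  fixes s0 :: "real poly"
  assumes c: "0 < c"
    and lower: "\<And>x. x \<in> {0..1} \<Longrightarrow> c < 1 + (1 - x) * poly s0 x"
    and upper: "\<And>x. x \<in> {0..1} \<Longrightarrow> c < 1 - x * poly s0 x"
  obtains s where "[:0, 1:] + [:0, 1, -1:] * s \<in> P'"
    and "\<And>x. x \<in> {0..1} \<Longrightarrow> \<bar>poly s x - poly s0 x\<bar> \<le> c"
proof -
  let ?U = "\<lambda>x. 1 + (1 - x) * poly s0 x" and ?V = "\<lambda>x. 1 - x * poly s0 x"
  have "open {x. 0 < ?U x \<and> 0 < ?V x}"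
    by (intro open_Collect_conj open_Collect_less continuous_intros)
  moreover have "0 < ?U a \<and> 0 < ?V a" if "a \<in> {0..1}" for a
    using lower[OF that] upper[OF that] c by linarith
  ultimately have near: "\<exists>\<delta>>0. \<forall>x. \<bar>x - a\<bar> < \<delta> \<longrightarrow> 0 < ?U x \<and> 0 < ?V x" if "a \<in> {0..1}" for a
    using that unfolding open_dist dist_real_def by blast
  obtain \<delta>0 where \<delta>0: "0 < \<delta>0" "\<And>x. \<bar>x\<bar> < \<delta>0 \<Longrightarrow> 0 < ?U x \<and> 0 < ?V x"
    using near[of 0] by auto
  obtain \<delta>1 where \<delta>1: "0 < \<delta>1" "\<And>x. \<bar>x - 1\<bar> < \<delta>1 \<Longrightarrow> 0 < ?U x \<and> 0 < ?V x"
    using near[of 1] by auto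
  define \<delta> where "\<delta> = min \<delta>0 \<delta>1"
  have \<delta>: "0 < \<delta>" using \<delta>0 \<delta>1 by (simp add: \<delta>_def)
  obtain N where N: "odd N"
    and dom: "\<And>x. 1 + \<delta> \<le> \<bar>2 * x - 1\<bar> \<Longrightarrow> \<bar>poly s0 x\<bar> \<le> c * \<bar>2 * x - 1\<bar> ^ N"
    using poly_dominated_by_odd_power[OF c \<delta>] by blast
  \<comment> \<open>Beyond distance \<open>\<delta>\<close> from the unit interval the odd power decides the sign of \<open>s\<close>; within that
    distance the monotone effect of the power preserves positivity of the cofactors for \<open>s0\<close>.\<close>
  define s where "s = s0 - smult c ([:-1, 2:] ^ N)"
  have s: "poly s x = poly s0 x - c * (2 * x - 1) ^ N" for x
    by (simp add: s_def poly_power algebra_simps)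
  have close: "\<bar>poly s x - poly s0 x\<bar> \<le> c" if "x \<in> {0..1}" for x
  proof -
    have "\<bar>2 * x - 1\<bar> ^ N \<le> 1"
      using that by (intro power_le_one) auto
    then show ?thesis using c by (simp add: s abs_mult power_abs)
  qed
  have "0 < 1 + (1 - x) * poly s x \<and> 0 < 1 - x * poly s x" for x
  proof -
    consider "x \<in> {0..1}" | "1 < x" | "x < 0" by fastforce
    then show ?thesis
    proof cases
      case 1
      have "\<bar>(1 - x) * (poly s x - poly s0 x)\<bar> \<le> 1 * c" "\<bar>x * (poly s x - poly s0 x)\<bar> \<le> 1 * c"
        unfolding abs_mult using 1 close[OF 1] by (intro mult_mono; simp)+
      then show ?thesis
        using lower[OF 1] upper[OF 1] by (simp add: algebra_simps abs_le_iff)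
    next
      case 2
      have pow: "0 \<le> (2 * x - 1) ^ N" using 2 by simp
      then have le: "poly s x \<le> poly s0 x" using c by (simp add: s)
      have "poly s x \<le> 0 \<or> 0 < ?U x \<and> 0 < ?V x"
      proof (cases "x < 1 + \<delta>")
        case True
        then show ?thesis using \<delta>1(2)[of x] 2 by (simp add: \<delta>_def)
      next
        case False
        then show ?thesis using dom[of x] \<delta> 2 by (auto simp: s)
      qed
      then show ?thesis
      proof
        assume "poly s x \<le> 0"
        then have "0 \<le> (1 - x) * poly s x" "x * poly s x \<le> 0"
          using 2 by (auto simp: mult_nonpos_nonpos mult_nonneg_nonpos)
        then show ?thesis by linarith
      next
        assume "0 < ?U x \<and> 0 < ?V x"
        moreover have "(1 - x) * poly s0 x \<le> (1 - x) * poly s x" "x * poly s x \<le> x * poly s0 x"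
          using le 2 by (auto intro: mult_left_mono_neg mult_left_mono)
        ultimately show ?thesis by linarith
      qed
    next
      case 3
      have y: "(2 * x - 1) ^ N = - (\<bar>2 * x - 1\<bar> ^ N)"
        using 3 N by (simp add: power_minus_odd[symmetric])
      then have le: "poly s0 x \<le> poly s x" using c by (simp add: s)
      have "0 \<le> poly s x \<or> 0 < ?U x \<and> 0 < ?V x"
      proof (cases "- \<delta> < x")
        case True
        then show ?thesis using \<delta>0(2)[of x] 3 by (simp add: \<delta>_def)
      next
        case False
        then show ?thesis using dom[of x] \<delta> 3 by (auto simp: s y)
      qed
      then show ?thesis
      proof
        assume "0 \<le> poly s x"
        then have "0 \<le> (1 - x) * poly s x" "x * poly s x \<le> 0"
          using 3 by (auto simp: mult_nonpos_nonneg)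
        then show ?thesis by linarith
      next
        assume "0 < ?U x \<and> 0 < ?V x"
        moreover have "(1 - x) * poly s0 x \<le> (1 - x) * poly s x" "x * poly s x \<le> x * poly s0 x"
          using le 3 by (auto intro: mult_left_mono_neg mult_left_mono)
        ultimately show ?thesis by linarith
      qed
    qed
  qed
  then have "[:0, 1:] + [:0, 1, -1:] * s \<in> P'"
    by (intro P'_if_cofactors_pos) auto
  then show thesis using that close by blast
qed

section \<open>Approximation on the unit interval\<close>

lemma poly_Weierstrass_unit_interval:
  fixes h :: "real \<Rightarrow> real"
  assumes "continuous_on {0..1} h" and "0 < e"
  obtains q where "\<And>x. x \<in> {0..1} \<Longrightarrow> \<bar>h x - poly q x\<bar> < e"
proof -
  obtain n where n: "\<And>x. x \<in> {0..1} \<Longrightarrow> \<bar>h x - (\<Sum>k\<le>n. h (k / n) * Bernstein n k x)\<bar> < e"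
    using Bernstein_Weierstrass[OF assms] by blast
  define q where "q = (\<Sum>k\<le>n. smult (h (k / n) * (n choose k)) ([:0, 1:] ^ k * [:1, -1:] ^ (n - k)))"
  have "poly q x = (\<Sum>k\<le>n. h (k / n) * Bernstein n k x)" for x
    by (simp add: q_def poly_sum poly_power Bernstein_def mult.assoc)
  then show thesis using that[of q] n by simp
qed

theorem corollary2p11:
  fixes A :: "real set" and f :: "real \<Rightarrow> real" and \<epsilon> :: real
  assumes "closed A" and "A \<subseteq> {0..1}"
    and "\<epsilon> > 0"
    and "continuous_on A f"
    and "\<forall>x\<in>A. 0 \<le> f x \<and> f x \<le> 1"
    and "0 \<in> A \<longrightarrow> f 0 = 0"
    and "1 \<in> A \<longrightarrow> f 1 = 1"
  shows "\<exists>p\<in>P'. (SUP x\<in>A. ereal \<bar>poly p x - f x\<bar>) < ereal \<epsilon>"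
proof -
  obtain g where g: "continuous_on UNIV g" "\<And>x. x \<in> A \<Longrightarrow> g x = f x" "\<And>x. g x \<in> {0..1}"
    using Tietze_closed_interval_1[of A f UNIV 0 1] assms(1,4,5) by auto
  define K where "K = {x \<in> A. \<epsilon> / 4 \<le> \<bar>f x - x\<bar>}"
  have "closed K"
    unfolding K_def using assms(1,4)
    by (intro continuous_on_closed_Collect_le continuous_intros)
  then have "compact K"
    using assms(2) by (auto simp: compact_eq_bounded_closed K_def intro: bounded_subset[of "{0..1}"])
  have Kpos: "0 < x * (1 - x)" if "x \<in> K" for x
  proof -
    have "x \<noteq> 0" "x \<noteq> 1" "x \<in> {0..1}"
      using that assms by (auto simp: K_def)
    then show ?thesis by auto
  qed
  obtain m where m: "0 < m" "\<And>x. x \<in> K \<Longrightarrow> m \<le> x * (1 - x)"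
  proof (cases "K = {}")
    case True
    then show thesis using that[of 1] by simp
  next
    case False
    have "continuous_on K (\<lambda>x. x * (1 - x))" by (intro continuous_intros)
    then show thesis
      using continuous_attains_inf[OF \<open>compact K\<close> False] Kpos that by metis
  qed
  \<comment> \<open>The choice of \<open>\<tau>\<close> gives \<open>\<tau> / m = \<epsilon> / 4\<close>, which bounds \<open>1 - \<theta>\<close> on \<open>K\<close>.\<close>
  define \<tau> where "\<tau> = m * \<epsilon> / 4"
  define \<eta> where "\<eta> = min (\<epsilon> / 4) (1 / 2)"
  have \<tau>: "0 < \<tau>" and \<eta>: "0 < \<eta>" "\<eta> < 1" "\<eta> \<le> \<epsilon> / 4"
    using assms(3) m(1) by (auto simp: \<tau>_def \<eta>_def)
  \<comment> \<open>\<open>h\<close> is the regularised cofactor; the function it produces is the convex combination of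
    \<open>g\<close> and the identity in which \<open>g\<close> has weight \<open>(1 - \<eta>) * \<theta>\<close>.\<close>
  define \<theta> where "\<theta> x = x * (1 - x) / (x * (1 - x) + \<tau>)" for x
  define h where "h x = (1 - \<eta>) * (g x - x) / (x * (1 - x) + \<tau>)" for x
  have den: "0 < x * (1 - x) + \<tau>" and nonneg: "0 \<le> x * (1 - x)" if "x \<in> {0..1}" for x
    using that \<tau> by (auto intro: add_nonneg_pos)
  have \<theta>: "0 \<le> \<theta> x" "\<theta> x \<le> 1" if "x \<in> {0..1}" for x
    using den[OF that] nonneg[OF that] \<tau> by (auto simp: \<theta>_def)
  have damp: "(1 - \<eta>) * \<theta> x \<le> 1 - \<eta>" if "x \<in> {0..1}" for x
    using \<theta>[OF that] \<eta> by (simp add: mult_left_le)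
  have h_eq: "x * (1 - x) * h x = (1 - \<eta>) * \<theta> x * (g x - x)" for x
    by (simp add: h_def \<theta>_def)
  \<comment> \<open>Since \<open>g\<close> lies in the unit interval, \<open>- x \<le> g x - x \<le> 1 - x\<close>. Each bound supplies just the
    factor that completes \<open>x * (1 - x)\<close>, the numerator of \<open>\<theta>\<close>.\<close>
  have h_lower: "\<eta> \<le> 1 + (1 - x) * h x" and h_upper: "\<eta> \<le> 1 - x * h x" if x: "x \<in> {0..1}" for x
  proof -
    let ?k = "(1 - \<eta>) / (x * (1 - x) + \<tau>)"
    have k: "0 \<le> ?k" using \<eta> den[OF x] by simp
    have h: "h x = ?k * (g x - x)" by (simp add: h_def)
    have "(1 - x) * (- x) \<le> (1 - x) * (g x - x)"
      using x g(3)[of x] by (intro mult_left_mono) auto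
    moreover have "x * (g x - x) \<le> x * (1 - x)"
      using x g(3)[of x] by (intro mult_left_mono) auto
    ultimately have "?k * ((1 - x) * (- x)) \<le> ?k * ((1 - x) * (g x - x))"
      and "?k * (x * (g x - x)) \<le> ?k * (x * (1 - x))"
      using k by (blast intro: mult_left_mono)+
    moreover have "?k * (x * (1 - x)) = (1 - \<eta>) * \<theta> x"
      by (simp add: \<theta>_def)
    ultimately have "- ((1 - \<eta>) * \<theta> x) \<le> (1 - x) * h x" "x * h x \<le> (1 - \<eta>) * \<theta> x"
      unfolding h by (simp_all only: mult_minus_right mult.left_commute mult.commute)
    then show "\<eta> \<le> 1 + (1 - x) * h x" "\<eta> \<le> 1 - x * h x"
      using damp[OF x] by linarith+
  qed
  have "\<forall>x\<in>{0..1}. x * (1 - x) + \<tau> \<noteq> 0"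
    using den by (metis less_irrefl)
  then have "continuous_on {0..1} h"
    unfolding h_def by (intro continuous_intros continuous_on_subset[OF g(1)] subset_UNIV)
  then obtain s0 where s0: "\<And>x. x \<in> {0..1} \<Longrightarrow> \<bar>h x - poly s0 x\<bar> < \<eta> / 2"
    using poly_Weierstrass_unit_interval[of h "\<eta> / 2"] \<eta> by auto
  have small: "\<bar>t * (h x - poly s0 x)\<bar> < \<eta> / 2" if "x \<in> {0..1}" "t \<in> {0..1}" for x t
  proof -
    have "\<bar>t * (h x - poly s0 x)\<bar> \<le> 1 * \<bar>h x - poly s0 x\<bar>"
      unfolding abs_mult using that by (intro mult_right_mono) auto
    also have "\<dots> < \<eta> / 2" using s0[OF that(1)] by simp
    finally show ?thesis .
  qed
  have "\<eta> / 2 < 1 + (1 - x) * poly s0 x" "\<eta> / 2 < 1 - x * poly s0 x" if x: "x \<in> {0..1}" for x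
  proof -
    have "\<bar>(1 - x) * h x - (1 - x) * poly s0 x\<bar> < \<eta> / 2" "\<bar>x * h x - x * poly s0 x\<bar> < \<eta> / 2"
      using small[OF x, of "1 - x"] small[OF x, of x] x by (simp_all add: right_diff_distrib)
    with h_lower[OF x] h_upper[OF x]
    show "\<eta> / 2 < 1 + (1 - x) * poly s0 x" "\<eta> / 2 < 1 - x * poly s0 x"
      by argo+
  qed
  then obtain s where P: "[:0, 1:] + [:0, 1, -1:] * s \<in> P'"
    and s: "\<And>x. x \<in> {0..1} \<Longrightarrow> \<bar>poly s x - poly s0 x\<bar> \<le> \<eta> / 2"
    using perturb_into_P'[of "\<eta> / 2" s0] \<eta> by auto
  define p where "p = [:0, 1:] + [:0, 1, -1:] * s"
  have "\<bar>poly p x - f x\<bar> \<le> 3 * \<epsilon> / 4" if A: "x \<in> A" for x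
  proof -
    have x: "x \<in> {0..1}" using A assms(2) by blast
    have d1: "\<bar>f x - x\<bar> \<le> 1" using A x assms(5) by force
    \<comment> \<open>One quarter of \<open>\<epsilon>\<close> each: replacing \<open>h\<close> by \<open>s\<close>, the regularisation \<open>\<tau>\<close>, and the factor
      \<open>1 - \<eta>\<close>.\<close>
    have "poly p x - f x = x * (1 - x) * (poly s x - h x) + (x * (1 - x) * h x - (f x - x))"
      by (simp add: p_def algebra_simps)
    also have "x * (1 - x) * h x - (f x - x) = - ((1 - \<theta> x) * (f x - x)) - \<eta> * \<theta> x * (f x - x)"
      unfolding h_eq g(2)[OF A] by (simp add: algebra_simps)
    finally have "\<bar>poly p x - f x\<bar> \<le> \<bar>x * (1 - x) * (poly s x - h x)\<bar>
        + \<bar>(1 - \<theta> x) * (f x - x)\<bar> + \<bar>\<eta> * \<theta> x * (f x - x)\<bar>"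
      by linarith
    moreover have "\<bar>x * (1 - x) * (poly s x - h x)\<bar> \<le> 1 * \<eta>"
    proof -
      have "\<bar>poly s x - h x\<bar> \<le> \<eta>" using s[OF x] s0[OF x] by linarith
      moreover have "\<bar>x * (1 - x)\<bar> \<le> 1"
        using x by (auto simp: abs_mult intro: mult_le_one)
      ultimately show ?thesis unfolding abs_mult[of "x * (1 - x)"] by (intro mult_mono) auto
    qed
    moreover have "\<bar>\<eta> * \<theta> x * (f x - x)\<bar> \<le> \<eta> * 1 * 1"
      unfolding abs_mult using \<theta>[OF x] \<eta> d1 by (intro mult_mono) auto
    moreover have "\<bar>(1 - \<theta> x) * (f x - x)\<bar> \<le> \<epsilon> / 4"
    proof (cases "x \<in> K")
      case True
      have "1 - \<theta> x = \<tau> / (x * (1 - x) + \<tau>)"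
        using den[OF x] by (simp add: \<theta>_def field_simps)
      also have "\<dots> \<le> \<tau> / m"
        using m(2)[OF True] m(1) \<tau> by (intro divide_left_mono) auto
      also have "\<dots> = \<epsilon> / 4" using m(1) by (simp add: \<tau>_def)
      finally have "\<bar>1 - \<theta> x\<bar> * \<bar>f x - x\<bar> \<le> \<epsilon> / 4 * 1"
        using \<theta>[OF x] d1 assms(3) by (intro mult_mono) auto
      then show ?thesis by (simp add: abs_mult)
    next
      case False
      then have "\<bar>1 - \<theta> x\<bar> * \<bar>f x - x\<bar> \<le> 1 * (\<epsilon> / 4)"
        using \<theta>[OF x] A by (intro mult_mono) (auto simp: K_def)
      then show ?thesis by (simp add: abs_mult)
    qed
    ultimately show ?thesis using \<eta>(3) by linarith
  qed
  then have "(SUP x\<in>A. ereal \<bar>poly p x - f x\<bar>) \<le> ereal (3 * \<epsilon> / 4)"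
    by (intro SUP_least) simp
  also have "\<dots> < ereal \<epsilon>" using assms(3) by simp
  finally show ?thesis using P unfolding p_def by blast
qed

end
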